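(* Let $n\in\mathbb N$. For $z,w\in T_\Omega$, the reproducing kernel of $H^n_{2,\rho}(T_\Omega)$ is given by $$K^{(n,\rho)}(z,w)=\int_{\Omega^\ast}\frac{e^{i\langle z-\overline w,\xi\rangle}}{w_n(\xi)}\,d\xi.$$ Equivalently, $$K^{(n,\rho)}_w(z)=\int_{\Omega^\ast}e^{i\langle z,\xi\rangle}\,\frac{e^{-i\langle\overline w,\xi\rangle}}{w_n(\xi)}\,d\xi.$$
   Context: Let $d\ge 1$ and let $\Omega\subset\mathbb R^d$ be a nonempty open convex cone containing no complete straight line. Its dual cone is $\Omega^\ast=\{\xi\in\mathbb R^d:\langle x,\xi\rangle\ge 0\text{ for all }x\in\Omega\}$, and $T_\Omega=\mathbb R^d+i\Omega\subset\mathbb C^d$ is the associated tube domain. For $z\in\mathbb C^d$, $\xi\in\mathbb R^d$, $\langle z,\xi\rangle=\sum_{j=1}^d z_j\xi_j$ (bilinear). Fix a continuous function $\rho:\Omega^\ast\to[0,\infty)$ with $\rho(\xi)>0$ for $\xi\ne 0$ and $\rho(t\xi)=t\rho(\xi)$ for all $t>0$, $\xi\in\Omega^\ast$ (so $\rho(0)=0$). For $n\in\mathbb N$ let $w_n(\xi)=\sum_{k=0}^n\rho(\xi)^{2k}$, and let $L^2(\Omega^\ast,w_n)$ be the space of (classes of) measurable complex functions $f$ on $\Omega^\ast$ with $\|f\|_{L^2(\Omega^\ast,w_n)}^2=\int_{\Omega^\ast}|f|^2w_n\,d\xi<\infty$. The Hilbertian Hardy--Sobolev space $H^n_{2,\rho}(T_\Omega)$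 consists of all holomorphic functions on $T_\Omega$ of the form $\mathcal Lf(z)=\int_{\Omega^\ast}e^{i\langle z,\xi\rangle}f(\xi)\,d\xi$ with $f\in L^2(\Omega^\ast,w_n)$. The map $\mathcal L$ is injective on $L^2(\Omega^\ast,w_n)$, and $H^n_{2,\rho}(T_\Omega)$ is a Hilbert space with inner product $\langle\mathcal Lf,\mathcal Lg\rangle=\int_{\Omega^\ast}f\overline g\,w_n\,d\xi$. Point evaluations at points of $T_\Omega$ are bounded on it. For $w\in T_\Omega$, $K^{(n,\rho)}_w\in H^n_{2,\rho}(T_\Omega)$ denotes the unique function with $F(w)=\langle F,K^{(n,\rho)}_w\rangle$ for all $F\in H^n_{2,\rho}(T_\Omega)$, and the reproducing kernel is $K^{(n,\rho)}(z,w):=K^{(n,\rho)}_w(z)$. *)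

theory Defs
  imports "HOL-Analysis.Analysis"
begin

definition dual_cone :: "(real^'d) set \<Rightarrow> (real^'d) set" where
  "dual_cone \<Omega> = {\<xi>. \<forall>x\<in>\<Omega>. x \<bullet> \<xi> \<ge> 0}"

definition tube :: "(real^'d) set \<Rightarrow> (complex^'d) set" where
  "tube \<Omega> = {z. (\<chi> j. Im (z $ j)) \<in> \<Omega>}"

text \<open>The pairing is bilinear: there is no complex conjugation.\<close>

definition cpair :: "complex^'d \<Rightarrow> real^'d \<Rightarrow> complex" where
  "cpair z \<xi> = (\<Sum>j\<in>UNIV. z $ j * complex_of_real (\<xi> $ j))"

definition cnj_vec :: "complex^'d \<Rightarrow> complex^'d" where
  "cnj_vec z = (\<chi> j. cnj (z $ j))"

text \<open>Holomorphy in several variables: Frechet differentiability with a complex linear derivative.\<close>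

definition holomorphic_vec_on :: "(complex^'d \<Rightarrow> complex) \<Rightarrow> (complex^'d) set \<Rightarrow> bool" where
  "holomorphic_vec_on F S \<longleftrightarrow>
     (\<forall>z\<in>S. \<exists>a :: complex^'d. (F has_derivative (\<lambda>h. \<Sum>j\<in>UNIV. a $ j * h $ j)) (at z within S))"

definition hs_weight :: "(real^'d \<Rightarrow> real) \<Rightarrow> nat \<Rightarrow> real^'d \<Rightarrow> real" where
  "hs_weight \<rho> n \<xi> = (\<Sum>k=0..n. \<rho> \<xi> ^ (2 * k))"

text \<open>Functions rather than classes modulo null sets; values outside the dual cone are irrelevant.\<close>

definition L2_weighted ::
  "(real^'d) set \<Rightarrow> (real^'d \<Rightarrow> real) \<Rightarrow> nat \<Rightarrow> (real^'d \<Rightarrow> complex) set" where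
  "L2_weighted \<Omega> \<rho> n =
     {f \<in> borel_measurable (lebesgue_on (dual_cone \<Omega>)).
        integrable (lebesgue_on (dual_cone \<Omega>)) (\<lambda>\<xi>. (cmod (f \<xi>))\<^sup>2 * hs_weight \<rho> n \<xi>)}"

text \<open>
  A function on the tube is represented by an extensional function (undefined off the tube),
  so that equality of representatives is equality of functions on the tube.
\<close>

definition laplace ::
  "(real^'d) set \<Rightarrow> (real^'d \<Rightarrow> complex) \<Rightarrow> complex^'d \<Rightarrow> complex" where
  "laplace \<Omega> f =
     (\<lambda>z\<in>tube \<Omega>. LINT \<xi>|lebesgue_on (dual_cone \<Omega>). exp (\<i> * cpair z \<xi>) * f \<xi>)"

definition hardy_sobolev ::
  "(real^'d) set \<Rightarrow> (real^'d \<Rightarrow> real) \<Rightarrow> nat \<Rightarrow> (complex^'d \<Rightarrow> complex) set" where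
  "hardy_sobolev \<Omega> \<rho> n =
     {F. holomorphic_vec_on F (tube \<Omega>) \<and> (\<exists>f\<in>L2_weighted \<Omega> \<rho> n. F = laplace \<Omega> f)}"

text \<open>
  The choice is immaterial for the inner product below: the Laplace transform is injective
  modulo null sets.
\<close>

definition hs_density ::
  "(real^'d) set \<Rightarrow> (real^'d \<Rightarrow> real) \<Rightarrow> nat \<Rightarrow> (complex^'d \<Rightarrow> complex) \<Rightarrow> real^'d \<Rightarrow> complex" where
  "hs_density \<Omega> \<rho> n F = (SOME f. f \<in> L2_weighted \<Omega> \<rho> n \<and> F = laplace \<Omega> f)"

definition hs_inner ::
  "(real^'d) set \<Rightarrow> (real^'d \<Rightarrow> real) \<Rightarrow> nat \<Rightarrow>
     (complex^'d \<Rightarrow> complex) \<Rightarrow> (complex^'d \<Rightarrow> complex) \<Rightarrow> complex" where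
  "hs_inner \<Omega> \<rho> n F G =
     (LINT \<xi>|lebesgue_on (dual_cone \<Omega>).
        hs_density \<Omega> \<rho> n F \<xi> * cnj (hs_density \<Omega> \<rho> n G \<xi>) * complex_of_real (hs_weight \<rho> n \<xi>))"

definition hs_kernel_at ::
  "(real^'d) set \<Rightarrow> (real^'d \<Rightarrow> real) \<Rightarrow> nat \<Rightarrow> complex^'d \<Rightarrow> complex^'d \<Rightarrow> complex" where
  "hs_kernel_at \<Omega> \<rho> n w =
     (THE K. K \<in> hardy_sobolev \<Omega> \<rho> n \<and> (\<forall>F\<in>hardy_sobolev \<Omega> \<rho> n. F w = hs_inner \<Omega> \<rho> n F K))"

definition hs_kernel ::
  "(real^'d) set \<Rightarrow> (real^'d \<Rightarrow> real) \<Rightarrow> nat \<Rightarrow> complex^'d \<Rightarrow> complex^'d \<Rightarrow> complex" where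
  "hs_kernel \<Omega> \<rho> n z w = hs_kernel_at \<Omega> \<rho> n w z"

end

theory Submission
  imports Defs
begin

text \<open>
  For a fixed point \<open>w\<close> of the tube, \<open>F w\<close> is the integral of \<open>exp (i\<langle>w, \<xi>\<rangle>) f \<xi>\<close>, where \<open>f\<close> is the
  density of \<open>F\<close>. Writing this as an inner product with weight \<open>w\<^sub>n\<close> forces the density of the kernel at
  \<open>w\<close> to be the conjugate of \<open>exp (i\<langle>w, \<xi>\<rangle>)\<close> divided by \<open>w\<^sub>n \<xi>\<close>, and its Laplace transform is the asserted
  integral. Three facts turn this computation into a proof.

  The kernel must belong to the space. An interior point \<open>y\<close> of the cone satisfies
  \<open>y \<bullet> \<xi> \<ge> \<delta> * norm \<xi>\<close> on the dual cone (\<open>dual_cone_coercive\<close>), so the exponentials involved are square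
  integrable (\<open>kernel_density_L2\<close>), and the resulting transform is holomorphic because the decay
  dominates the Taylor remainder (\<open>holomorphic_laplace\<close>).

  The inner product is defined through a chosen density, so a function may have only one density up to
  null sets (\<open>laplace_eq_imp_AE_eq\<close>). Instead of Fourier inversion in several variables the proof uses the
  points \<open>iy\<close> only: the exponentials \<open>exp (- (y \<bullet> \<xi>))\<close> with \<open>y \<in> \<Omega>\<close> span an algebra, since \<open>\<Omega>\<close> is closed
  under addition, and they separate points, since \<open>\<Omega>\<close> is open. Finitely many of them embed the dual cone
  into a compact ball (\<open>exponential_embedding\<close>), and the Weierstrass approximation theorem there shows
  that a function orthogonal to all of them vanishes almost everywhere (\<open>exp_null_imp_AE_zero\<close>).

  Finally the reproducing function is unique (\<open>reproducing_unique\<close>), so the definite description that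
  defines the kernel denotes the one computed above.
\<close>

section \<open>Exponential decay and vanishing criteria\<close>

lemma power_le_fact_mult_exp:
  fixes t :: real
  assumes "t \<ge> 0"
  shows "t ^ k \<le> fact k * exp t"
proof -
  have "t ^ k /\<^sub>R fact k \<le> exp t"
    unfolding exp_def using assms sum_le_suminf[OF summable_exp_generic[of t], of "{k}"] by simp
  then show ?thesis by (simp add: field_simps)
qed

text \<open>
  Cover the space by the balls of radius \<open>n + 1\<close>: a point \<open>x\<close> lies in the one with
  \<open>n = \<lfloor>norm x\<rfloor>\<close>, where the integrand is at most \<open>exp (- c n)\<close>, while the volume of that ball
  grows only like \<open>(n + 1) ^ DIM('a)\<close>.
\<close>

lemma integrable_exp_minus_norm:
  fixes c :: real
  assumes "c > 0"
  shows "integrable lborel (\<lambda>x::'a::euclidean_space. exp (- (c * norm x)))"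
proof (rule integrableI_bounded)
  let ?V = "unit_ball_vol (real DIM('a))" and ?D = "DIM('a)"
  let ?a = "\<lambda>n::nat. exp (- (c * real n)) * (?V * (real n + 1) ^ ?D)"
  show "(\<lambda>x::'a. exp (- (c * norm x))) \<in> borel_measurable lborel"
    by (simp add: borel_measurable_continuous_onI continuous_intros)
  have V: "?V \<ge> 0" by (simp add: unit_ball_vol_def)
  have sm: "summable ?a"
  proof (rule summable_comparison_test')
    (* Half of the exponential decay absorbs the polynomial growth of the volume. *)
    let ?K = "?V * (fact ?D * exp (c / 2) / (c / 2) ^ ?D)"
    show "summable (\<lambda>n. ?K * exp (- (c / 2)) ^ n)"
      using assms by (intro summable_mult summable_geometric) simp
    show "norm (?a n) \<le> ?K * exp (- (c / 2)) ^ n" for n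
    proof -
      have "(c / 2 * (real n + 1)) ^ ?D \<le> fact ?D * exp (c / 2 * (real n + 1))"
        using assms by (intro power_le_fact_mult_exp) simp
      then have "(real n + 1) ^ ?D \<le> fact ?D * exp (c / 2 * (real n + 1)) / (c / 2) ^ ?D"
        using assms by (simp add: power_mult_distrib pos_le_divide_eq mult.commute del: times_divide_eq_left times_divide_eq_right power_divide)
      then have "?a n \<le> exp (- (c * real n)) * (?V * (fact ?D * exp (c / 2 * (real n + 1)) / (c / 2) ^ ?D))"
        using V by (intro mult_left_mono) auto
      also have "\<dots> = ?K * (exp (- (c * real n)) * exp (c / 2 * real n))"
        by (simp add: distrib_left exp_add)
      also have "exp (- (c * real n)) * exp (c / 2 * real n) = exp (- (c / 2)) ^ n"
        by (simp flip: exp_add exp_of_nat_mult)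
      finally show ?thesis using V by simp
    qed
  qed
  have "nn_integral (lborel :: 'a measure) (\<lambda>x. ennreal (norm (exp (- (c * norm x)))))
      \<le> nn_integral (lborel :: 'a measure)
          (\<lambda>x. \<Sum>n. ennreal (exp (- (c * real n))) * indicator (cball 0 (real n + 1)) x)"
  proof (rule nn_integral_mono)
    fix x :: 'a
    let ?n = "nat \<lfloor>norm x\<rfloor>"
    have n: "real ?n \<le> norm x" "norm x \<le> real ?n + 1" by (auto simp: floor_le_iff)
    have "ennreal (norm (exp (- (c * norm x)))) \<le> ennreal (exp (- (c * real ?n))) * indicator (cball 0 (real ?n + 1)) x"
      using n assms by (auto simp: indicator_def intro!: ennreal_leI mult_left_mono)
    also have "\<dots> \<le> (\<Sum>n. ennreal (exp (- (c * real n))) * indicator (cball 0 (real n + 1)) x)"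
      using sum_le_suminf[of "\<lambda>n. ennreal (exp (- (c * real n))) * indicator (cball 0 (real n + 1)) x" "{?n}"] by simp
    finally show "ennreal (norm (exp (- (c * norm x)))) \<le> \<dots>" .
  qed
  also have "\<dots> = (\<Sum>n. ennreal (?a n))"
  proof (subst nn_integral_suminf)
    show "(\<lambda>x::'a. ennreal (exp (- (c * real n))) * indicator (cball 0 (real n + 1)) x) \<in> borel_measurable lborel" for n
      by (intro borel_measurable_times_ennreal borel_measurable_const borel_measurable_indicator) simp
    show "(\<Sum>n. \<integral>\<^sup>+ x. ennreal (exp (- (c * real n))) * indicator (cball (0::'a) (real n + 1)) x \<partial>lborel)
        = (\<Sum>n. ennreal (?a n))"
      by (subst nn_integral_cmult_indicator) (simp_all add: emeasure_cball V ennreal_mult)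
  qed
  also have "\<dots> < \<infinity>"
    using sm V by (subst suminf_ennreal2) auto
  finally show "nn_integral (lborel :: 'a measure) (\<lambda>x. ennreal (norm (exp (- (c * norm x))))) < \<infinity>" .
qed

text \<open>
  A Lebesgue set is, up to a null set, an increasing union of compact sets. So by dominated
  convergence the integral vanishes over every measurable set, which forces the integrand to vanish.
\<close>

lemma AE_zero_if_integrals_over_compact_zero:
  fixes g :: "'a::euclidean_space \<Rightarrow> 'b::{banach, second_countable_topology}"
  assumes S: "S \<in> sets lebesgue" and g: "integrable (lebesgue_on S) g"
    and zero: "\<And>C. compact C \<Longrightarrow> (LINT x|lebesgue_on S. indicator C x *\<^sub>R g x) = 0"
  shows "AE x in lebesgue_on S. g x = 0"
proof -
  interpret sigma_finite_measure "lebesgue_on S"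
  proof
    show "\<exists>A. countable A \<and> A \<subseteq> sets (lebesgue_on S) \<and> \<Union> A = space (lebesgue_on S)
            \<and> (\<forall>a\<in>A. emeasure (lebesgue_on S) a \<noteq> \<infinity>)"
    proof -
      have in_sets: "cball 0 (real n) \<inter> S \<in> sets (lebesgue_on S)" for n
        using sets.Int[OF _ S, of "cball 0 (real n)"] S by (simp add: sets_restrict_space_iff)
      show ?thesis
      proof (intro exI[of _ "range (\<lambda>n. cball 0 (real n) \<inter> S)"] conjI ballI)
        show "\<Union> (range (\<lambda>n. cball 0 (real n) \<inter> S)) = space (lebesgue_on S)"
          by (auto simp: real_arch_simple)
        fix a assume "a \<in> range (\<lambda>n. cball 0 (real n) \<inter> S)"
        then obtain n where a: "a = cball 0 (real n) \<inter> S" by auto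
        have "emeasure (lebesgue_on S) a = emeasure lebesgue a"
          using S a by (simp add: emeasure_restrict_space)
        also have "\<dots> \<le> emeasure lebesgue (cball (0::'a) (real n))"
          unfolding a by (intro emeasure_mono) auto
        also have "\<dots> < \<infinity>" by (simp add: emeasure_cball)
        finally show "emeasure (lebesgue_on S) a \<noteq> \<infinity>" by simp
      qed (use S in_sets in auto)
    qed
  qed
  show ?thesis
  proof (rule density_zero[OF g])
    fix A assume A: "A \<in> sets (lebesgue_on S)"
    have AL: "A \<in> sets lebesgue" "A \<subseteq> S"
      using A S by (auto simp: sets_restrict_space_iff)
    obtain C T where CT: "fsigma C" "T \<in> null_sets lebesgue" "C \<union> T = A" "disjnt C T"
      using lebesgue_set_almost_fsigma[OF AL(1)] .
    obtain F :: "nat \<Rightarrow> 'a set" where F: "\<And>n. closed (F n)" and CF: "C = (\<Union>n. F n)"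
      using CT(1) by cases auto
    (* Truncating the finite unions makes them compact, and they still increase to C. *)
    define D where "D n = (\<Union>i\<le>n. F i) \<inter> cball 0 (real n)" for n
    have D: "compact (D n)" for n
      unfolding D_def by (intro closed_Int_compact closed_UN compact_cball) (auto simp: F)
    have meas: "E \<in> sets lebesgue \<Longrightarrow> indicator E \<in> borel_measurable (lebesgue_on S)" for E :: "'a set"
      by (auto intro!: measurable_restrict_space1)
    have DL: "D n \<in> sets lebesgue" for n
      using D[of n] by (simp add: borel_compact)
    have CL: "C \<in> sets lebesgue" using CF F by auto
    have lim: "(\<lambda>n. indicator (D n) x :: real) \<longlonglongrightarrow> indicator C x" for x
    proof (cases "x \<in> C")
      case True
      then obtain i where i: "x \<in> F i" using CF by auto
      obtain m :: nat where m: "norm x \<le> real m" using real_arch_simple by blast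
      have "x \<in> D n" if "n \<ge> max i m" for n
        using that i m by (auto simp: D_def intro!: bexI[of _ i] order_trans[OF m])
      then have "eventually (\<lambda>n. indicator (D n) x = (indicator C x :: real)) sequentially"
        using True by (auto simp: eventually_sequentially intro!: exI[of _ "max i m"])
      then show ?thesis by (rule tendsto_eventually)
    next
      case False
      then have "x \<notin> D n" for n by (auto simp: D_def CF)
      then show ?thesis using False by simp
    qed
    have "(\<lambda>n. LINT x|lebesgue_on S. indicator (D n) x *\<^sub>R g x)
        \<longlonglongrightarrow> (LINT x|lebesgue_on S. indicator C x *\<^sub>R g x)"
    proof (rule integral_dominated_convergence[where w = "\<lambda>x. norm (g x)"])
      show "AE x in lebesgue_on S. (\<lambda>n. indicator (D n) x *\<^sub>R g x) \<longlonglongrightarrow> indicator C x *\<^sub>R g x"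
        by (intro AE_I2 tendsto_intros lim)
      show "AE x in lebesgue_on S. norm (indicator (D n) x *\<^sub>R g x) \<le> norm (g x)" for n
        by (simp add: indicator_def)
    qed (use g in \<open>auto intro!: borel_measurable_scaleR meas CL DL\<close>)
    then have "(LINT x|lebesgue_on S. indicator C x *\<^sub>R g x) = 0"
      using zero[OF D] by (simp add: LIMSEQ_const_iff)
    also have "(LINT x|lebesgue_on S. indicator C x *\<^sub>R g x) = (LINT x|lebesgue_on S. indicator A x *\<^sub>R g x)"
    proof (rule integral_cong_AE)
      have "AE x in lebesgue. x \<notin> T" using CT(2) by (rule AE_not_in)
      then have "AE x in lebesgue_on S. x \<notin> T"
        using S by (simp add: AE_restrict_space_iff eventually_mono)
      then show "AE x in lebesgue_on S. indicator C x *\<^sub>R g x = indicator A x *\<^sub>R g x"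
        using CT(3) by (auto simp: indicator_def elim!: eventually_mono)
    qed (use g in \<open>auto intro!: borel_measurable_scaleR meas CL AL(1)\<close>)
    finally show "(LINT x:A|lebesgue_on S. g x) = 0"
      by (simp add: set_lebesgue_integral_def)
  qed
qed

section \<open>The tube and the dual cone\<close>

lemma borel_measurable_cnj [measurable]: "cnj \<in> borel_measurable borel"
  by (intro borel_measurable_continuous_onI continuous_intros)

definition Im_vec :: "complex^'d \<Rightarrow> real^'d" where
  "Im_vec z = (\<chi> j. Im (z $ j))"

lemma mem_tube_iff: "z \<in> tube \<Omega> \<longleftrightarrow> Im_vec z \<in> \<Omega>"
  by (simp add: tube_def Im_vec_def)

lemma cpair_add: "cpair (z + h) \<xi> = cpair z \<xi> + cpair h \<xi>"
  by (simp add: cpair_def distrib_right sum.distrib)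

lemma cpair_diff: "cpair (z - h) \<xi> = cpair z \<xi> - cpair h \<xi>"
  by (simp add: cpair_def left_diff_distrib sum_subtractf)

lemma cpair_cnj_vec: "cpair (cnj_vec z) \<xi> = cnj (cpair z \<xi>)"
  by (simp add: cpair_def cnj_vec_def)

lemma norm_exp_i_cpair: "norm (exp (\<i> * cpair z \<xi>)) = exp (- (Im_vec z \<bullet> \<xi>))"
  by (simp add: norm_exp_eq_Re cpair_def Im_vec_def inner_vec_def)

lemma norm_cpair_le: "norm (cpair (h :: complex^'d) \<xi>) \<le> real CARD('d) * norm h * norm \<xi>"
proof -
  have "norm (cpair h \<xi>) \<le> (\<Sum>j\<in>(UNIV::'d set). norm h * norm \<xi>)"
    unfolding cpair_def
  proof (rule order_trans[OF norm_sum], rule sum_mono)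
    fix j :: 'd
    have "norm (\<xi> $ j) \<le> norm \<xi>" "norm (h $ j) \<le> norm h"
      by (rule Finite_Cartesian_Product.norm_nth_le)+
    then show "norm (h $ j * complex_of_real (\<xi> $ j)) \<le> norm h * norm \<xi>"
      by (simp add: norm_mult mult_mono)
  qed
  then show ?thesis by simp
qed

lemma continuous_on_cpair [continuous_intros]: "continuous_on S (cpair z)"
  unfolding cpair_def by (intro continuous_intros)

lemma closed_dual_cone: "closed (dual_cone \<Omega>)"
proof -
  have "dual_cone \<Omega> = (\<Inter>x\<in>\<Omega>. {\<xi>. x \<bullet> \<xi> \<ge> 0})" by (auto simp: dual_cone_def)
  then show ?thesis by (auto intro!: closed_INT closed_halfspace_ge)
qed

lemma dual_cone_sets_lebesgue [simp]: "dual_cone \<Omega> \<in> sets lebesgue"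
  by (simp add: closed_dual_cone borel_closed)

lemma measurable_lebesgue_on_continuous:
  fixes f :: "real^'d \<Rightarrow> 'b::euclidean_space"
  shows "continuous_on UNIV f \<Longrightarrow> f \<in> borel_measurable (lebesgue_on (dual_cone \<Omega>))"
  by (rule continuous_imp_measurable_on_sets_lebesgue) (auto intro: continuous_on_subset)

text \<open>
  Since \<open>\<Omega>\<close> is open, \<open>y\<close> may be moved inside \<open>\<Omega>\<close> by a fixed distance \<open>\<delta>\<close> against the direction of
  \<open>\<xi>\<close>; the pairing with \<open>\<xi>\<close> is still nonnegative there, so it was at least \<open>\<delta> * norm \<xi>\<close> before.
  This is what makes every integral below converge.
\<close>

lemma dual_cone_coercive:
  assumes "open \<Omega>" "y \<in> \<Omega>"
  obtains \<delta> where "\<delta> > 0" "\<And>\<xi>. \<xi> \<in> dual_cone \<Omega> \<Longrightarrow> \<delta> * norm \<xi> \<le> y \<bullet> \<xi>"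
proof -
  obtain \<delta> where \<delta>: "\<delta> > 0" "cball y \<delta> \<subseteq> \<Omega>"
    using assms open_contains_cball by blast
  have "\<delta> * norm \<xi> \<le> y \<bullet> \<xi>" if "\<xi> \<in> dual_cone \<Omega>" for \<xi>
  proof (cases "\<xi> = 0")
    case False
    have "y - (\<delta> / norm \<xi>) *\<^sub>R \<xi> \<in> \<Omega>"
      using \<delta> False by (intro subsetD[OF \<delta>(2)]) (simp add: dist_norm)
    then have "0 \<le> (y - (\<delta> / norm \<xi>) *\<^sub>R \<xi>) \<bullet> \<xi>"
      using that by (auto simp: dual_cone_def)
    then show ?thesis
      using False by (simp add: inner_diff_left dot_square_norm power2_eq_square)
  qed simp
  with \<delta>(1) show ?thesis by (rule that)
qed

lemma integrable_exp_minus_inner_dual_cone: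
  assumes "open \<Omega>" "y \<in> \<Omega>"
  shows "integrable (lebesgue_on (dual_cone \<Omega>)) (\<lambda>\<xi>. exp (- (y \<bullet> \<xi>)))"
proof -
  obtain \<delta> where \<delta>: "\<delta> > 0" "\<And>\<xi>. \<xi> \<in> dual_cone \<Omega> \<Longrightarrow> \<delta> * norm \<xi> \<le> y \<bullet> \<xi>"
    by (rule dual_cone_coercive[OF assms]) blast
  have "integrable lebesgue (\<lambda>\<xi>::real^'a. exp (- (\<delta> * norm \<xi>)))"
    using integrable_exp_minus_norm[OF \<delta>(1)] by (simp add: integrable_completion)
  then have "integrable (lebesgue_on (dual_cone \<Omega>)) (\<lambda>\<xi>. exp (- (\<delta> * norm \<xi>)))"
    by (intro integrable_mult_indicator integrable_restrict_space[THEN iffD2]) auto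
  then show ?thesis
    by (rule Bochner_Integration.integrable_bound)
       (auto intro!: measurable_lebesgue_on_continuous continuous_intros AE_I2 \<delta>(2))
qed

section \<open>Injectivity of the Laplace transform\<close>

locale open_convex_cone =
  fixes \<Omega> :: "(real^'d) set"
  assumes nonempty: "\<Omega> \<noteq> {}"
    and open_set: "open \<Omega>"
    and convex_set: "convex \<Omega>"
    and scaleR_mem: "\<And>x t. x \<in> \<Omega> \<Longrightarrow> t > 0 \<Longrightarrow> t *\<^sub>R x \<in> \<Omega>"
begin

abbreviation "\<Gamma> \<equiv> dual_cone \<Omega>"
abbreviation "M \<equiv> lebesgue_on \<Gamma>"

lemma add_mem: "x \<in> \<Omega> \<Longrightarrow> y \<in> \<Omega> \<Longrightarrow> x + y \<in> \<Omega>"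
  using convexD[OF convex_set, of "2 *\<^sub>R x" "2 *\<^sub>R y" "1/2" "1/2"] scaleR_mem[of _ 2] by simp

text \<open>
  The coordinates of \<open>\<Phi>\<close> are \<open>exp (- (a \<bullet> \<xi>))\<close> and \<open>exp (- (y i \<bullet> \<xi>))\<close>, where \<open>y i\<close> is the point
  \<open>a \<in> \<Omega>\<close> moved a little along the \<open>i\<close>-th axis. Dividing by the first coordinate recovers each \<open>\<xi> $ i\<close>,
  so \<open>\<Phi>\<close> is injective; the extra coordinate avoids choosing a basis of the space inside \<open>\<Omega>\<close>.
  On the dual cone all coordinates lie in \<open>{0<..1}\<close>, so that polynomials in \<open>\<Phi>\<close>, which are exponential
  sums with frequencies in \<open>\<Omega> \<union> {0}\<close>, can approximate continuous functions of \<open>\<Phi>\<close> uniformly.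
\<close>

lemma exponential_embedding:
  obtains \<Phi> :: "real^'d \<Rightarrow> real \<times> (real^'d)"
  where "continuous_on UNIV \<Phi>" "inj \<Phi>"
    "\<And>b. b \<in> Basis \<Longrightarrow> \<exists>y\<in>\<Omega>. \<forall>\<xi>. \<Phi> \<xi> \<bullet> b = exp (- (y \<bullet> \<xi>))"
proof -
  obtain a where a: "a \<in> \<Omega>" using nonempty by blast
  obtain \<epsilon> where \<epsilon>: "\<epsilon> > 0" "cball a \<epsilon> \<subseteq> \<Omega>"
    using a open_set open_contains_cball by blast
  define y where "y i = a + \<epsilon> *\<^sub>R axis i 1" for i
  have y: "y i \<in> \<Omega>" for i
    using \<epsilon> by (intro subsetD[OF \<epsilon>(2)]) (simp add: y_def dist_norm)
  define \<Phi> where "\<Phi> \<xi> = (exp (- (a \<bullet> \<xi>)), \<chi> i. exp (- (y i \<bullet> \<xi>)))" for \<xi> :: "real^'d"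
  show ?thesis
  proof (rule that[of \<Phi>])
    show "continuous_on UNIV \<Phi>"
      unfolding \<Phi>_def[abs_def] by (intro continuous_intros)
    show "inj \<Phi>"
    proof (rule injI)
      fix \<xi> \<eta> assume eq: "\<Phi> \<xi> = \<Phi> \<eta>"
      then have 1: "a \<bullet> \<xi> = a \<bullet> \<eta>" by (simp add: \<Phi>_def)
      have "y i \<bullet> \<xi> = y i \<bullet> \<eta>" for i
        using eq by (auto simp: \<Phi>_def vec_eq_iff)
      with 1 have "\<xi> $ i = \<eta> $ i" for i
        using \<epsilon>(1) by (auto simp: y_def inner_add_left inner_axis' )
      then show "\<xi> = \<eta>" by (simp add: vec_eq_iff)
    qed
    fix b :: "real \<times> (real^'d)" assume "b \<in> Basis"
    then consider "b = (1, 0)" | i where "b = (0, axis i 1)"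
      by (auto simp: Basis_prod_def Basis_vec_def)
    then show "\<exists>y\<in>\<Omega>. \<forall>\<xi>. \<Phi> \<xi> \<bullet> b = exp (- (y \<bullet> \<xi>))"
    proof cases
      case 1
      then show ?thesis using a by (intro bexI[of _ a]) (auto simp: \<Phi>_def)
    next
      case (2 i)
      then show ?thesis using y by (intro bexI[of _ "y i"]) (auto simp: \<Phi>_def inner_axis)
    qed
  qed
qed

text \<open>
  The functions on the dual cone whose Laplace transform converges on \<open>i\<Omega>\<close> and vanishes there. The
  condition is imposed at all \<open>y \<in> \<Omega>\<close> at once, so that the class is stable under multiplication by the
  exponentials \<open>exp (- (y \<bullet> \<xi>))\<close>, \<open>\<Omega>\<close> being closed under addition.
\<close>
definition exp_null :: "(real^'d \<Rightarrow> 'b::{banach, second_countable_topology}) \<Rightarrow> bool" where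
  "exp_null h \<longleftrightarrow> (\<forall>y\<in>\<Omega>. has_bochner_integral M (\<lambda>\<xi>. exp (- (y \<bullet> \<xi>)) *\<^sub>R h \<xi>) 0)"

lemma exp_null_add:
  assumes "exp_null g" "exp_null h"
  shows "exp_null (\<lambda>\<xi>. g \<xi> + h \<xi>)"
  unfolding exp_null_def
proof
  fix y assume "y \<in> \<Omega>"
  then show "has_bochner_integral M (\<lambda>\<xi>. exp (- (y \<bullet> \<xi>)) *\<^sub>R (g \<xi> + h \<xi>)) 0"
    using assms has_bochner_integral_add[of M "\<lambda>\<xi>. exp (- (y \<bullet> \<xi>)) *\<^sub>R g \<xi>" 0
        "\<lambda>\<xi>. exp (- (y \<bullet> \<xi>)) *\<^sub>R h \<xi>" 0]
    by (simp add: scaleR_add_right exp_null_def)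
qed

lemma exp_null_scaleR:
  assumes "exp_null h"
  shows "exp_null (\<lambda>\<xi>. c *\<^sub>R h \<xi>)"
  unfolding exp_null_def
proof
  fix y assume "y \<in> \<Omega>"
  then have "has_bochner_integral M (\<lambda>\<xi>. c *\<^sub>R exp (- (y \<bullet> \<xi>)) *\<^sub>R h \<xi>) (c *\<^sub>R 0)"
    using assms by (intro has_bochner_integral_scaleR_right) (simp add: exp_null_def)
  then show "has_bochner_integral M (\<lambda>\<xi>. exp (- (y \<bullet> \<xi>)) *\<^sub>R c *\<^sub>R h \<xi>) 0"
    by (simp add: mult.commute)
qed

lemma exp_null_sum:
  "finite I \<Longrightarrow> (\<And>i. i \<in> I \<Longrightarrow> exp_null (h i)) \<Longrightarrow> exp_null (\<lambda>\<xi>. \<Sum>i\<in>I. h i \<xi>)"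
proof (induction I rule: finite_induct)
  case empty
  then show ?case by (simp add: exp_null_def has_bochner_integral_zero)
next
  case (insert i I)
  then show ?case by (simp add: exp_null_add)
qed

lemma exp_null_exp: "exp_null h \<Longrightarrow> y \<in> \<Omega> \<Longrightarrow> exp_null (\<lambda>\<xi>. exp (- (y \<bullet> \<xi>)) *\<^sub>R h \<xi>)"
  unfolding exp_null_def
proof
  fix x assume "y \<in> \<Omega>" "x \<in> \<Omega>"
    and "\<forall>y\<in>\<Omega>. has_bochner_integral M (\<lambda>\<xi>. exp (- (y \<bullet> \<xi>)) *\<^sub>R h \<xi>) 0"
  then have "has_bochner_integral M (\<lambda>\<xi>. exp (- ((x + y) \<bullet> \<xi>)) *\<^sub>R h \<xi>) 0"
    using add_mem by blast
  then show "has_bochner_integral M (\<lambda>\<xi>. exp (- (x \<bullet> \<xi>)) *\<^sub>R exp (- (y \<bullet> \<xi>)) *\<^sub>R h \<xi>) 0"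
    by (simp add: inner_add_left exp_diff exp_minus divide_inverse)
qed

text \<open>
  The coordinates of \<open>\<Phi>\<close> are exponentials, so multiplication by a linear function of \<open>\<Phi>\<close> preserves
  the class; products of polynomials then act one factor after the other. Quantifying over \<open>h\<close> in the
  induction is what allows this.
\<close>

lemma exp_null_polynomial:
  fixes \<Phi> :: "real^'d \<Rightarrow> 'e::euclidean_space"
  assumes \<Phi>: "\<And>b. b \<in> Basis \<Longrightarrow> \<exists>y\<in>\<Omega>. \<forall>\<xi>. \<Phi> \<xi> \<bullet> b = exp (- (y \<bullet> \<xi>))"
    and "real_polynomial_function P" "exp_null h"
  shows "exp_null (\<lambda>\<xi>. P (\<Phi> \<xi>) *\<^sub>R h \<xi>)"
  using assms(2,3)
proof (induction arbitrary: h rule: real_polynomial_function.induct)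
  case (linear f)
  have "f (\<Phi> \<xi>) *\<^sub>R h \<xi> = (\<Sum>b\<in>Basis. f b *\<^sub>R (\<Phi> \<xi> \<bullet> b) *\<^sub>R h \<xi>)" for \<xi>
  proof -
    interpret bounded_linear f by fact
    have "f (\<Phi> \<xi>) = f (\<Sum>b\<in>Basis. (\<Phi> \<xi> \<bullet> b) *\<^sub>R b)" by (simp add: euclidean_representation)
    also have "\<dots> = (\<Sum>b\<in>Basis. f b * (\<Phi> \<xi> \<bullet> b))" by (simp add: sum scaleR mult.commute)
    finally show ?thesis by (simp add: scaleR_left.sum)
  qed
  moreover have "exp_null (\<lambda>\<xi>. (\<Phi> \<xi> \<bullet> b) *\<^sub>R h \<xi>)" if "b \<in> Basis" for b
    using \<Phi>[OF that] exp_null_exp[OF linear(2)] by auto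
  ultimately show ?case
    by (simp only:) (intro exp_null_sum exp_null_scaleR finite_Basis)
next
  case (const c)
  then show ?case by (rule exp_null_scaleR)
next
  case (add f g)
  then show ?case by (auto simp: scaleR_add_left intro!: exp_null_add)
next
  case (mult f g)
  from mult.IH(1)[OF mult.IH(2)[OF mult.prems]] show ?case by simp
qed

text \<open>
  The map \<open>\<Phi>\<close> sends the dual cone into a compact ball, on which a continuous \<open>G\<close> is a uniform limit of
  polynomials; for these the integral vanishes. The factor \<open>exp (- (y \<bullet> \<xi>))\<close> makes the
  measure finite, so that uniform approximation suffices.
\<close>

lemma exp_null_imp_integral_zero:
  fixes \<Phi> :: "real^'d \<Rightarrow> 'e::euclidean_space" and G :: "'e \<Rightarrow> real"
  assumes cont: "continuous_on UNIV \<Phi>"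
    and \<Phi>: "\<And>b. b \<in> Basis \<Longrightarrow> \<exists>y\<in>\<Omega>. \<forall>\<xi>. \<Phi> \<xi> \<bullet> b = exp (- (y \<bullet> \<xi>))"
    and G: "continuous_on UNIV G" and h: "exp_null h" and y: "y \<in> \<Omega>"
  shows "(LINT \<xi>|M. G (\<Phi> \<xi>) *\<^sub>R exp (- (y \<bullet> \<xi>)) *\<^sub>R h \<xi>) = 0"
proof -
  define g where "g \<xi> = exp (- (y \<bullet> \<xi>)) *\<^sub>R h \<xi>" for \<xi>
  have g: "integrable M g"
    using h y by (auto simp: exp_null_def g_def[abs_def] has_bochner_integral_iff)
  have bnd: "norm (\<Phi> \<xi>) \<le> real DIM('e)" if "\<xi> \<in> \<Gamma>" for \<xi>
  proof -
    have "norm (\<Phi> \<xi>) \<le> (\<Sum>b\<in>Basis. \<bar>\<Phi> \<xi> \<bullet> b\<bar>)" by (rule norm_le_l1)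
    also have "\<dots> \<le> (\<Sum>b\<in>(Basis::'e set). 1)"
    proof (rule sum_mono)
      fix b :: 'e assume "b \<in> Basis"
      then obtain x where "x \<in> \<Omega>" "\<Phi> \<xi> \<bullet> b = exp (- (x \<bullet> \<xi>))" using \<Phi> by blast
      then show "\<bar>\<Phi> \<xi> \<bullet> b\<bar> \<le> 1" using that by (simp add: dual_cone_def)
    qed
    finally show ?thesis by simp
  qed
  let ?K = "cball (0::'e) (real DIM('e))"
  have inK: "\<Phi> \<xi> \<in> ?K" if "\<xi> \<in> \<Gamma>" for \<xi> using bnd[OF that] by simp
  obtain B where B: "\<And>t. t \<in> ?K \<Longrightarrow> norm (G t) \<le> B"
    using compact_imp_bounded[OF compact_continuous_image[OF continuous_on_subset[OF G] compact_cball]]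
    unfolding bounded_iff by (metis image_eqI subset_UNIV)
  have int: "integrable M (\<lambda>\<xi>. G (\<Phi> \<xi>) *\<^sub>R g \<xi>)"
  proof (rule Bochner_Integration.integrable_bound)
    show "integrable M (\<lambda>\<xi>. B * norm (g \<xi>))" using g by simp
    have "(\<lambda>\<xi>. G (\<Phi> \<xi>)) \<in> borel_measurable M"
      by (intro measurable_lebesgue_on_continuous continuous_on_compose2[OF G cont]) auto
    then show "(\<lambda>\<xi>. G (\<Phi> \<xi>) *\<^sub>R g \<xi>) \<in> borel_measurable M" using g by auto
    show "AE \<xi> in M. norm (G (\<Phi> \<xi>) *\<^sub>R g \<xi>) \<le> norm (B * norm (g \<xi>))"
      using B[OF inK] by (intro AE_I2) (auto intro!: mult_right_mono order_trans[OF _ abs_ge_self] simp: abs_mult)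
  qed
  have le: "norm (LINT \<xi>|M. G (\<Phi> \<xi>) *\<^sub>R g \<xi>) \<le> e * (LINT \<xi>|M. norm (g \<xi>))" if "e > 0" for e
  proof -
    obtain P where P: "real_polynomial_function P" "\<And>t. t \<in> ?K \<Longrightarrow> \<bar>G t - P t\<bar> < e"
      using Stone_Weierstrass_real_polynomial_function[OF compact_cball continuous_on_subset[OF G] \<open>e > 0\<close>]
      by (metis subset_UNIV)
    have p0: "has_bochner_integral M (\<lambda>\<xi>. P (\<Phi> \<xi>) *\<^sub>R g \<xi>) 0"
      using exp_null_polynomial[OF \<Phi> P(1) h] y
      by (auto simp: exp_null_def g_def mult.commute)
    have "norm (LINT \<xi>|M. G (\<Phi> \<xi>) *\<^sub>R g \<xi>) = norm (LINT \<xi>|M. (G (\<Phi> \<xi>) - P (\<Phi> \<xi>)) *\<^sub>R g \<xi>)"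
      using int p0 by (simp add: has_bochner_integral_iff scaleR_diff_left)
    also have "\<dots> \<le> (LINT \<xi>|M. e * norm (g \<xi>))"
    proof (rule Bochner_Integration.integral_norm_bound_integral)
      show "integrable M (\<lambda>\<xi>. (G (\<Phi> \<xi>) - P (\<Phi> \<xi>)) *\<^sub>R g \<xi>)"
        using int p0 by (simp add: has_bochner_integral_iff scaleR_diff_left)
      show "norm ((G (\<Phi> \<xi>) - P (\<Phi> \<xi>)) *\<^sub>R g \<xi>) \<le> e * norm (g \<xi>)" if "\<xi> \<in> space M" for \<xi>
        using P(2)[OF inK, of \<xi>] that by (auto intro!: mult_right_mono)
    qed (use g in auto)
    finally show ?thesis by simp
  qed
  have "norm (LINT \<xi>|M. G (\<Phi> \<xi>) *\<^sub>R g \<xi>) \<le> 0"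
  proof (rule field_le_epsilon)
    fix e :: real assume "e > 0"
    define J where "J = (LINT \<xi>|M. norm (g \<xi>))"
    have J: "J \<ge> 0" unfolding J_def by simp
    have "norm (LINT \<xi>|M. G (\<Phi> \<xi>) *\<^sub>R g \<xi>) \<le> e / (J + 1) * J"
      using le[of "e / (J + 1)"] \<open>e > 0\<close> J by (simp add: J_def[symmetric])
    also have "\<dots> \<le> e"
      using \<open>e > 0\<close> J by (simp add: divide_le_eq)
    finally show "norm (LINT \<xi>|M. G (\<Phi> \<xi>) *\<^sub>R g \<xi>) \<le> 0 + e" by simp
  qed
  then show ?thesis by (simp add: g_def)
qed

text \<open>
  Because \<open>\<Phi>\<close> is injective, the indicator of a compact set \<open>C\<close> is the pointwise limit of continuous
  functions of \<open>\<Phi>\<close>, namely of cut-offs of the distance to \<open>\<Phi> ` C\<close>. Hence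
  \<open>exp (- (y \<bullet> \<xi>)) *\<^sub>R h \<xi>\<close> has zero integral over every compact set.
\<close>

theorem exp_null_imp_AE_zero:
  assumes h: "exp_null h"
  shows "AE \<xi> in M. h \<xi> = 0"
proof -
  obtain \<Phi> :: "real^'d \<Rightarrow> real \<times> (real^'d)" where cont: "continuous_on UNIV \<Phi>" and inj: "inj \<Phi>"
    and \<Phi>: "\<And>b. b \<in> Basis \<Longrightarrow> \<exists>y\<in>\<Omega>. \<forall>\<xi>. \<Phi> \<xi> \<bullet> b = exp (- (y \<bullet> \<xi>))"
    by (rule exponential_embedding) blast
  obtain y where y: "y \<in> \<Omega>" using nonempty by blast
  define g where "g \<xi> = exp (- (y \<bullet> \<xi>)) *\<^sub>R h \<xi>" for \<xi>
  have g: "integrable M g"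
    using h y by (auto simp: exp_null_def g_def[abs_def] has_bochner_integral_iff)
  have "AE \<xi> in M. g \<xi> = 0"
  proof (rule AE_zero_if_integrals_over_compact_zero[OF _ g])
    fix C :: "(real^'d) set" assume C: "compact C"
    show "(LINT \<xi>|M. indicator C \<xi> *\<^sub>R g \<xi>) = 0"
    proof (cases "C = {}")
      case False
      define G where "G n t = max 0 (1 - real n * infdist t (\<Phi> ` C))" for n t
      have GC: "continuous_on UNIV (G n)" for n
        unfolding G_def by (intro continuous_intros)
      have clos: "closed (\<Phi> ` C)"
        using C cont by (intro compact_imp_closed compact_continuous_image) (auto intro: continuous_on_subset)
      have lim: "(\<lambda>n. G n (\<Phi> \<xi>)) \<longlonglongrightarrow> indicator C \<xi>" for \<xi>
      proof (cases "\<xi> \<in> C")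
        case True
        then show ?thesis by (simp add: G_def)
      next
        case False
        then have "\<Phi> \<xi> \<notin> \<Phi> ` C" using inj by (auto dest: injD)
        then have pos: "infdist (\<Phi> \<xi>) (\<Phi> ` C) > 0"
          using clos \<open>C \<noteq> {}\<close> by (intro infdist_pos_not_in_closed) auto
        then obtain m :: nat where m: "real m * infdist (\<Phi> \<xi>) (\<Phi> ` C) > 1"
          using reals_Archimedean3 by blast
        have "G n (\<Phi> \<xi>) = indicator C \<xi>" if "n \<ge> m" for n
        proof -
          have "real m * infdist (\<Phi> \<xi>) (\<Phi> ` C) \<le> real n * infdist (\<Phi> \<xi>) (\<Phi> ` C)"
            using that pos by (intro mult_right_mono) auto
          then show ?thesis using m False by (simp add: G_def)
        qed
        then show ?thesis
          by (intro tendsto_eventually) (auto simp: eventually_sequentially)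
      qed
      have "(\<lambda>n. LINT \<xi>|M. G n (\<Phi> \<xi>) *\<^sub>R g \<xi>) \<longlonglongrightarrow> (LINT \<xi>|M. indicator C \<xi> *\<^sub>R g \<xi>)"
      proof (rule integral_dominated_convergence[where w = "\<lambda>\<xi>. norm (g \<xi>)"])
        have "C \<in> sets lebesgue" using C by (simp add: borel_compact)
        then have "(indicator C :: _ \<Rightarrow> real) \<in> borel_measurable M"
          by (auto intro!: measurable_restrict_space1)
        then show "(\<lambda>\<xi>. indicator C \<xi> *\<^sub>R g \<xi>) \<in> borel_measurable M" using g by auto
        have "(\<lambda>\<xi>. G n (\<Phi> \<xi>)) \<in> borel_measurable M" for n
          by (intro measurable_lebesgue_on_continuous continuous_on_compose2[OF GC cont]) auto
        then show "(\<lambda>\<xi>. G n (\<Phi> \<xi>) *\<^sub>R g \<xi>) \<in> borel_measurable M" for n using g by auto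
        show "AE \<xi> in M. (\<lambda>n. G n (\<Phi> \<xi>) *\<^sub>R g \<xi>) \<longlonglongrightarrow> indicator C \<xi> *\<^sub>R g \<xi>"
          by (intro AE_I2 tendsto_intros lim)
        have "\<bar>G n (\<Phi> \<xi>)\<bar> \<le> 1" for n \<xi>
          using infdist_nonneg[of "\<Phi> \<xi>" "\<Phi> ` C"] by (simp add: G_def)
        then show "AE \<xi> in M. norm (G n (\<Phi> \<xi>) *\<^sub>R g \<xi>) \<le> norm (g \<xi>)" for n
          by (intro AE_I2) (simp add: mult_left_le_one_le)
      qed (use g in auto)
      moreover have "(LINT \<xi>|M. G n (\<Phi> \<xi>) *\<^sub>R g \<xi>) = 0" for n
        unfolding g_def by (rule exp_null_imp_integral_zero[OF cont \<Phi> GC h y])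
      ultimately show ?thesis by (simp add: LIMSEQ_const_iff)
    qed simp
  qed simp
  then show ?thesis by (simp add: g_def)
qed

definition exp_integrable :: "(real^'d \<Rightarrow> complex) \<Rightarrow> bool" where
  "exp_integrable f \<longleftrightarrow> (\<forall>y\<in>\<Omega>. integrable M (\<lambda>\<xi>. exp (- (y \<bullet> \<xi>)) *\<^sub>R f \<xi>))"

lemma exp_integrable_measurable:
  assumes "exp_integrable f"
  shows "f \<in> borel_measurable M"
proof -
  obtain y where "y \<in> \<Omega>" using nonempty by blast
  then have 1: "(\<lambda>\<xi>. exp (- (y \<bullet> \<xi>)) *\<^sub>R f \<xi>) \<in> borel_measurable M"
    using assms by (auto simp: exp_integrable_def)
  have "(\<lambda>\<xi>. exp (y \<bullet> \<xi>)) \<in> borel_measurable M"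
    by (intro measurable_lebesgue_on_continuous continuous_intros)
  then have "(\<lambda>\<xi>. exp (y \<bullet> \<xi>) *\<^sub>R exp (- (y \<bullet> \<xi>)) *\<^sub>R f \<xi>) \<in> borel_measurable M"
    using 1 by (rule borel_measurable_scaleR)
  then show ?thesis by (simp add: exp_minus)
qed

lemma measurable_exp_cpair: "(\<lambda>\<xi>. exp (\<i> * cpair z \<xi>)) \<in> borel_measurable M"
  by (intro measurable_lebesgue_on_continuous continuous_intros)

lemma integrable_laplace:
  assumes f: "exp_integrable f" and z: "z \<in> tube \<Omega>"
  shows "integrable M (\<lambda>\<xi>. exp (\<i> * cpair z \<xi>) * f \<xi>)"
proof (rule Bochner_Integration.integrable_bound)
  show "integrable M (\<lambda>\<xi>. exp (- (Im_vec z \<bullet> \<xi>)) *\<^sub>R f \<xi>)"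
    using assms by (auto simp: exp_integrable_def mem_tube_iff)
  show "(\<lambda>\<xi>. exp (\<i> * cpair z \<xi>) * f \<xi>) \<in> borel_measurable M"
    using measurable_exp_cpair exp_integrable_measurable[OF f] by (rule borel_measurable_times)
qed (simp add: norm_mult norm_exp_i_cpair del: norm_exp_eq_Re)

text \<open>
  Already the values at the purely imaginary points \<open>iy\<close> of the tube, where the transform is the real
  exponential integral studied above, determine the density.
\<close>

lemma laplace_eq_imp_AE_eq:
  assumes f: "exp_integrable f" and g: "exp_integrable g" and eq: "laplace \<Omega> f = laplace \<Omega> g"
  shows "AE \<xi> in M. f \<xi> = g \<xi>"
proof -
  have "exp_null (\<lambda>\<xi>. f \<xi> - g \<xi>)"
    unfolding exp_null_def
  proof
    fix y assume y: "y \<in> \<Omega>"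
    define z :: "complex^'d" where "z = (\<chi> j. \<i> * complex_of_real (y $ j))"
    have z: "z \<in> tube \<Omega>" using y by (simp add: z_def tube_def)
    have e: "exp (\<i> * cpair z \<xi>) = complex_of_real (exp (- (y \<bullet> \<xi>)))" for \<xi>
    proof -
      have "\<i> * cpair z \<xi> = complex_of_real (- (y \<bullet> \<xi>))"
        by (simp add: cpair_def z_def inner_vec_def sum_distrib_left sum_negf mult.assoc[symmetric])
      then show ?thesis by (simp only: exp_of_real)
    qed
    have "laplace \<Omega> f z = laplace \<Omega> g z" using eq by simp
    then have "(LINT \<xi>|M. exp (\<i> * cpair z \<xi>) * f \<xi>) = (LINT \<xi>|M. exp (\<i> * cpair z \<xi>) * g \<xi>)"
      using z by (simp add: laplace_def)
    then have "has_bochner_integral M (\<lambda>\<xi>. exp (\<i> * cpair z \<xi>) * f \<xi> - exp (\<i> * cpair z \<xi>) * g \<xi>) 0"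
      using integrable_laplace[OF f z] integrable_laplace[OF g z]
      by (simp add: has_bochner_integral_iff)
    then show "has_bochner_integral M (\<lambda>\<xi>. exp (- (y \<bullet> \<xi>)) *\<^sub>R (f \<xi> - g \<xi>)) 0"
      by (simp add: e scaleR_conv_of_real right_diff_distrib)
  qed
  then have "AE \<xi> in M. f \<xi> - g \<xi> = 0" by (rule exp_null_imp_AE_zero)
  then show ?thesis by simp
qed

section \<open>Holomorphy of the Laplace transform\<close>

text \<open>
  The derivative is the integral of the formal derivative \<open>i\<xi> exp (i\<langle>z, \<xi>\<rangle>) f \<xi>\<close>. The Taylor
  remainder of the exponential is at most \<open>(norm h)\<^sup>2\<close> times a function that grows like
  \<open>(norm \<xi>)\<^sup>2 * exp (c * norm h * norm \<xi>)\<close>, and half of the decay of \<open>exp (- (y \<bullet> \<xi>))\<close>, with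
  \<open>y\<close> the imaginary part of \<open>z\<close>, pays for this growth when \<open>h\<close> is small. The other half is kept in the
  integrable majorant \<open>q\<close>.
\<close>

lemma holomorphic_laplace:
  assumes f: "exp_integrable f"
  shows "holomorphic_vec_on (laplace \<Omega> f) (tube \<Omega>)"
  unfolding holomorphic_vec_on_def
proof
  fix z assume z: "z \<in> tube \<Omega>"
  define y where "y = Im_vec z"
  have y: "y \<in> \<Omega>" using z by (simp add: y_def mem_tube_iff)
  obtain \<delta> where \<delta>: "\<delta> > 0" "\<And>\<xi>. \<xi> \<in> \<Gamma> \<Longrightarrow> \<delta> * norm \<xi> \<le> y \<bullet> \<xi>"
    by (rule dual_cone_coercive[OF open_set y]) blast
  define q where "q \<xi> = exp (- ((1/2) *\<^sub>R y \<bullet> \<xi>)) * norm (f \<xi>)" for \<xi>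
  have q: "integrable M q"
  proof -
    have "integrable M (\<lambda>\<xi>. norm (exp (- ((1/2) *\<^sub>R y \<bullet> \<xi>)) *\<^sub>R f \<xi>))"
      using f scaleR_mem[OF y, of "1/2"] unfolding exp_integrable_def by (intro integrable_norm) auto
    then show ?thesis by (simp add: q_def[abs_def])
  qed
  define c where "c = real CARD('d)"
  have c: "c > 0" by (simp add: c_def)
  (* Of the decay delta * norm xi / 2 that may be spent, one quarter of delta goes to the power of
     norm xi and one quarter to the exponential with rate r. *)
  have poly: "norm \<xi> ^ k * exp (r * norm \<xi>) * exp (- (y \<bullet> \<xi>)) * norm (f \<xi>) \<le> fact k * (4 / \<delta>) ^ k * q \<xi>"
    if "\<xi> \<in> \<Gamma>" "r \<le> \<delta> / 4" for k r \<xi>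
  proof -
    have "(\<delta> / 4 * norm \<xi>) ^ k \<le> fact k * exp (\<delta> / 4 * norm \<xi>)"
      using \<delta>(1) by (intro power_le_fact_mult_exp) simp
    then have "norm \<xi> ^ k \<le> fact k * (4 / \<delta>) ^ k * exp (\<delta> / 4 * norm \<xi>)"
      using \<delta>(1) by (simp add: power_mult_distrib power_divide field_simps)
    moreover have "exp (r * norm \<xi>) \<le> exp (\<delta> / 4 * norm \<xi>)"
      using mult_right_mono[OF that(2) norm_ge_zero[of \<xi>]] by simp
    ultimately have "norm \<xi> ^ k * exp (r * norm \<xi>)
        \<le> (fact k * (4 / \<delta>) ^ k * exp (\<delta> / 4 * norm \<xi>)) * exp (\<delta> / 4 * norm \<xi>)"
      using \<delta>(1) by (intro mult_mono) auto
    also have "\<dots> = fact k * (4 / \<delta>) ^ k * exp (\<delta> * norm \<xi> / 2)"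
      by (simp add: mult.assoc flip: exp_add)
    also have "\<dots> \<le> fact k * (4 / \<delta>) ^ k * exp (y \<bullet> \<xi> / 2)"
      using \<delta> that by (intro mult_left_mono) auto
    finally have "norm \<xi> ^ k * exp (r * norm \<xi>) * (exp (- (y \<bullet> \<xi>)) * norm (f \<xi>))
        \<le> fact k * (4 / \<delta>) ^ k * exp (y \<bullet> \<xi> / 2) * (exp (- (y \<bullet> \<xi>)) * norm (f \<xi>))"
      by (rule mult_right_mono) simp
    also have "\<dots> = fact k * (4 / \<delta>) ^ k * q \<xi>"
      by (simp add: q_def mult.assoc[symmetric]) (simp add: mult.assoc flip: exp_add)
    finally show ?thesis by (simp add: mult.assoc)
  qed
  define D where "D j \<xi> = exp (\<i> * cpair z \<xi>) * (\<i> * complex_of_real (\<xi> $ j)) * f \<xi>" for j \<xi>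
  have D: "integrable M (D j)" for j
  proof (rule Bochner_Integration.integrable_bound)
    show "integrable M (\<lambda>\<xi>. fact 1 * (4 / \<delta>) ^ 1 * q \<xi>)" using q by simp
    have "(\<lambda>\<xi>. exp (\<i> * cpair z \<xi>) * (\<i> * complex_of_real (\<xi> $ j))) \<in> borel_measurable M"
      by (intro measurable_lebesgue_on_continuous continuous_intros)
    then show "D j \<in> borel_measurable M"
      unfolding D_def[abs_def] using exp_integrable_measurable[OF f] by (rule borel_measurable_times)
    show "AE \<xi> in M. norm (D j \<xi>) \<le> norm (fact 1 * (4 / \<delta>) ^ 1 * q \<xi>)"
    proof (rule AE_I2)
      fix \<xi> assume "\<xi> \<in> space M"
      then have "norm \<xi> ^ 1 * exp (0 * norm \<xi>) * exp (- (y \<bullet> \<xi>)) * norm (f \<xi>) \<le> fact 1 * (4 / \<delta>) ^ 1 * q \<xi>"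
        using \<delta>(1) by (intro poly) auto
      moreover have "norm (D j \<xi>) \<le> norm \<xi> ^ 1 * exp (0 * norm \<xi>) * exp (- (y \<bullet> \<xi>)) * norm (f \<xi>)"
        using mult_right_mono[OF component_le_norm_cart[of \<xi> j], of "exp (- (y \<bullet> \<xi>)) * norm (f \<xi>)"]
        by (simp add: D_def norm_mult norm_exp_i_cpair y_def mult_ac del: norm_exp_eq_Re)
      ultimately show "norm (D j \<xi>) \<le> norm (fact 1 * (4 / \<delta>) ^ 1 * q \<xi>)"
        by (metis abs_ge_self order_trans real_norm_def)
    qed
  qed
  define a :: "complex^'d" where "a = (\<chi> j. LINT \<xi>|M. D j \<xi>)"
  define L where "L h = (\<Sum>j\<in>UNIV. a $ j * h $ j)" for h :: "complex^'d"
  define E where "E h \<xi> = exp (\<i> * cpair z \<xi>) * (\<i> * cpair h \<xi>) * f \<xi>" for h \<xi>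
  have E: "has_bochner_integral M (E h) (L h)" for h
  proof -
    have "has_bochner_integral M (\<lambda>\<xi>. \<Sum>j\<in>UNIV. D j \<xi> * h $ j) (\<Sum>j\<in>UNIV. (LINT \<xi>|M. D j \<xi>) * h $ j)"
      using D by (intro has_bochner_integral_sum has_bochner_integral_mult_left has_bochner_integral_integrable)
    moreover have "(\<Sum>j\<in>UNIV. D j \<xi> * h $ j) = E h \<xi>" for \<xi>
      by (simp add: D_def E_def cpair_def sum_distrib_left sum_distrib_right mult_ac)
    ultimately show ?thesis by (simp add: L_def a_def)
  qed
  define B where "B = c\<^sup>2 * (fact 2 * (4 / \<delta>)\<^sup>2) * (LINT \<xi>|M. q \<xi>)"
  have B: "B \<ge> 0" unfolding B_def using \<delta>(1) by (auto simp: q_def intro!: mult_nonneg_nonneg integral_nonneg)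
  have quad: "norm (laplace \<Omega> f (z + h) - laplace \<Omega> f z - L h) \<le> B * (norm h)\<^sup>2"
    if h: "z + h \<in> tube \<Omega>" "c * norm h \<le> \<delta> / 4" for h
  proof -
    let ?R = "\<lambda>\<xi>. exp (\<i> * cpair (z + h) \<xi>) * f \<xi> - exp (\<i> * cpair z \<xi>) * f \<xi> - E h \<xi>"
    have R: "has_bochner_integral M ?R (laplace \<Omega> f (z + h) - laplace \<Omega> f z - L h)"
      using integrable_laplace[OF f z] integrable_laplace[OF f h(1)] z h(1) E
      by (intro has_bochner_integral_diff) (auto simp: laplace_def has_bochner_integral_integrable)
    have "norm (LINT \<xi>|M. ?R \<xi>) \<le> (LINT \<xi>|M. c\<^sup>2 * (norm h)\<^sup>2 * (fact 2 * (4 / \<delta>)\<^sup>2 * q \<xi>))"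
    proof (rule Bochner_Integration.integral_norm_bound_integral)
      fix \<xi> assume "\<xi> \<in> space M"
      then have \<xi>: "\<xi> \<in> \<Gamma>" by simp
      let ?v = "\<i> * cpair h \<xi>"
      have v: "norm ?v \<le> c * norm h * norm \<xi>"
        using norm_cpair_le[of h \<xi>] by (simp add: norm_mult c_def)
      have "norm (exp ?v - 1 - ?v) \<le> exp (norm ?v) * (norm ?v)\<^sup>2"
        using Taylor_exp_field[of ?v 1] by (simp add: power2_eq_square diff_diff_eq)
      also have "\<dots> \<le> exp (c * norm h * norm \<xi>) * (c * norm h * norm \<xi>)\<^sup>2"
        using v by (intro mult_mono power_mono) auto
      finally have t: "norm (exp ?v - 1 - ?v) \<le> exp (c * norm h * norm \<xi>) * (c * norm h * norm \<xi>)\<^sup>2" .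
      have "?R \<xi> = exp (\<i> * cpair z \<xi>) * (exp ?v - 1 - ?v) * f \<xi>"
        by (simp add: E_def cpair_add distrib_left exp_add algebra_simps)
      then have "norm (?R \<xi>) = norm (exp ?v - 1 - ?v) * (exp (- (y \<bullet> \<xi>)) * norm (f \<xi>))"
        by (simp add: norm_mult norm_exp_i_cpair y_def del: norm_exp_eq_Re)
      also have "\<dots> \<le> exp (c * norm h * norm \<xi>) * (c * norm h * norm \<xi>)\<^sup>2 * (exp (- (y \<bullet> \<xi>)) * norm (f \<xi>))"
        using t by (rule mult_right_mono) simp
      also have "\<dots> = c\<^sup>2 * (norm h)\<^sup>2 * (norm \<xi> ^ 2 * exp (c * norm h * norm \<xi>) * exp (- (y \<bullet> \<xi>)) * norm (f \<xi>))"
        by (simp add: power_mult_distrib mult_ac)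
      also have "\<dots> \<le> c\<^sup>2 * (norm h)\<^sup>2 * (fact 2 * (4 / \<delta>)\<^sup>2 * q \<xi>)"
        using poly[OF \<xi> h(2), of 2] by (intro mult_left_mono) auto
      finally show "norm (?R \<xi>) \<le> c\<^sup>2 * (norm h)\<^sup>2 * (fact 2 * (4 / \<delta>)\<^sup>2 * q \<xi>)" .
    qed (use R q in \<open>auto simp: has_bochner_integral_iff\<close>)
    also have "\<dots> = B * (norm h)\<^sup>2" by (simp add: B_def)
    finally show ?thesis using R by (simp add: has_bochner_integral_iff)
  qed
  have "((\<lambda>x. norm (laplace \<Omega> f x - laplace \<Omega> f z - L (x - z)) / norm (x - z)) \<longlongrightarrow> 0) (at z within tube \<Omega>)"
  proof (rule tendsto_sandwich[where f = "\<lambda>_. 0" and h = "\<lambda>x. B * norm (x - z)"])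
    show "\<forall>\<^sub>F x in at z within tube \<Omega>. norm (laplace \<Omega> f x - laplace \<Omega> f z - L (x - z)) / norm (x - z) \<le> B * norm (x - z)"
      unfolding eventually_at
    proof (intro exI[of _ "\<delta> / (4 * c)"] conjI ballI impI)
      fix x assume x: "x \<in> tube \<Omega>" "x \<noteq> z \<and> dist x z < \<delta> / (4 * c)"
      then have "c * norm (x - z) \<le> \<delta> / 4"
        using c by (simp add: dist_norm field_simps)
      then have "norm (laplace \<Omega> f x - laplace \<Omega> f z - L (x - z)) \<le> B * (norm (x - z))\<^sup>2"
        using quad[of "x - z"] x by simp
      then show "norm (laplace \<Omega> f x - laplace \<Omega> f z - L (x - z)) / norm (x - z) \<le> B * norm (x - z)"
        using x by (simp add: pos_divide_le_eq power2_eq_square mult.assoc)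
    qed (use \<delta> c in simp)
    have "((\<lambda>x. B * norm (x - z)) \<longlongrightarrow> B * norm (z - z)) (at z within tube \<Omega>)"
      by (intro tendsto_intros)
    then show "((\<lambda>x. B * norm (x - z)) \<longlongrightarrow> 0) (at z within tube \<Omega>)" by simp
  qed auto
  moreover have "bounded_linear L"
    unfolding L_def[abs_def]
    by (intro bounded_linear_sum bounded_linear_const_mult bounded_linear_vec_nth)
  ultimately have "(laplace \<Omega> f has_derivative L) (at z within tube \<Omega>)"
    by (simp add: has_derivative_iff_norm)
  then show "\<exists>a :: complex^'d. (laplace \<Omega> f has_derivative (\<lambda>h. \<Sum>j\<in>UNIV. a $ j * h $ j)) (at z within tube \<Omega>)"
    unfolding L_def[abs_def] by blast
qed

end

section \<open>The reproducing kernel\<close>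

locale weighted_cone = open_convex_cone \<Omega> for \<Omega> :: "(real^'d) set" +
  fixes \<rho> :: "real^'d \<Rightarrow> real" and n :: nat
  assumes continuous_rho: "continuous_on (dual_cone \<Omega>) \<rho>"
begin

abbreviation "W \<equiv> hs_weight \<rho> n"

lemma weight_ge_1: "W \<xi> \<ge> 1"
proof -
  have "\<rho> \<xi> ^ (2 * 0) \<le> (\<Sum>k=0..n. \<rho> \<xi> ^ (2 * k))"
    by (rule member_le_sum) (auto simp: power_mult)
  then show ?thesis by (simp add: hs_weight_def)
qed

lemma weight_measurable: "W \<in> borel_measurable M"
  unfolding hs_weight_def
  by (rule continuous_imp_measurable_on_sets_lebesgue) (auto intro!: continuous_intros continuous_rho)

text \<open>
  The weight is at least 1, so \<open>f\<close> is square integrable, and so is \<open>exp (- (y \<bullet> \<xi>))\<close> because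
  \<open>2y \<in> \<Omega>\<close>.
\<close>

lemma L2_weighted_exp_integrable:
  assumes f: "f \<in> L2_weighted \<Omega> \<rho> n"
  shows "exp_integrable f"
  unfolding exp_integrable_def
proof
  fix y assume y: "y \<in> \<Omega>"
  have [measurable]: "f \<in> borel_measurable M" and fi: "integrable M (\<lambda>\<xi>. (cmod (f \<xi>))\<^sup>2 * W \<xi>)"
    using f by (auto simp: L2_weighted_def)
  have ei: "integrable M (\<lambda>\<xi>. exp (- (2 *\<^sub>R y \<bullet> \<xi>)))"
    using scaleR_mem[OF y, of 2] by (intro integrable_exp_minus_inner_dual_cone open_set) auto
  have em: "(\<lambda>\<xi>. exp (- (y \<bullet> \<xi>))) \<in> borel_measurable M"
    by (intro measurable_lebesgue_on_continuous continuous_intros)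
  show "integrable M (\<lambda>\<xi>. exp (- (y \<bullet> \<xi>)) *\<^sub>R f \<xi>)"
  proof (rule Bochner_Integration.integrable_bound[OF Bochner_Integration.integrable_add[OF fi ei]])
    show "(\<lambda>\<xi>. exp (- (y \<bullet> \<xi>)) *\<^sub>R f \<xi>) \<in> borel_measurable M"
      using em by (rule borel_measurable_scaleR) simp
    show "AE \<xi> in M. norm (exp (- (y \<bullet> \<xi>)) *\<^sub>R f \<xi>)
        \<le> norm ((cmod (f \<xi>))\<^sup>2 * W \<xi> + exp (- (2 *\<^sub>R y \<bullet> \<xi>)))"
    proof (rule AE_I2)
      fix \<xi>
      let ?e = "exp (- (y \<bullet> \<xi>))" and ?f = "cmod (f \<xi>)"
      have "0 \<le> ?e * ?f" by simp
      with sum_squares_bound[of ?e ?f] have "?e * ?f \<le> ?f\<^sup>2 * 1 + ?e\<^sup>2"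
        by linarith
      also have "\<dots> \<le> ?f\<^sup>2 * W \<xi> + ?e\<^sup>2"
        using weight_ge_1 by (intro add_right_mono mult_left_mono) auto
      also have "?e\<^sup>2 = exp (- (2 *\<^sub>R y \<bullet> \<xi>))" by (simp flip: exp_double)
      finally show "norm (?e *\<^sub>R f \<xi>) \<le> norm (?f\<^sup>2 * W \<xi> + exp (- (2 *\<^sub>R y \<bullet> \<xi>)))"
        by simp
    qed
  qed
qed

lemma L2_weighted_integrable_mult:
  assumes f: "f \<in> L2_weighted \<Omega> \<rho> n" and g: "g \<in> L2_weighted \<Omega> \<rho> n"
  shows "integrable M (\<lambda>\<xi>. f \<xi> * cnj (g \<xi>) * complex_of_real (W \<xi>))"
proof (rule Bochner_Integration.integrable_bound)
  have [measurable]: "f \<in> borel_measurable M" "g \<in> borel_measurable M" "W \<in> borel_measurable M"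
    using f g weight_measurable by (auto simp: L2_weighted_def)
  show "integrable M (\<lambda>\<xi>. (cmod (f \<xi>))\<^sup>2 * W \<xi> + (cmod (g \<xi>))\<^sup>2 * W \<xi>)"
    using f g by (auto simp: L2_weighted_def)
  show "(\<lambda>\<xi>. f \<xi> * cnj (g \<xi>) * complex_of_real (W \<xi>)) \<in> borel_measurable M" by measurable
  show "AE \<xi> in M. norm (f \<xi> * cnj (g \<xi>) * complex_of_real (W \<xi>))
      \<le> norm ((cmod (f \<xi>))\<^sup>2 * W \<xi> + (cmod (g \<xi>))\<^sup>2 * W \<xi>)"
  proof (rule AE_I2)
    fix \<xi>
    let ?f = "cmod (f \<xi>)" and ?g = "cmod (g \<xi>)"
    have W: "W \<xi> \<ge> 0" using weight_ge_1[of \<xi>] by simp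
    have "0 \<le> ?f * ?g" by simp
    with sum_squares_bound[of ?f ?g] have "?f * ?g \<le> ?f\<^sup>2 + ?g\<^sup>2"
      by linarith
    then have "?f * ?g * W \<xi> \<le> (?f\<^sup>2 + ?g\<^sup>2) * W \<xi>" using W by (rule mult_right_mono)
    then show "norm (f \<xi> * cnj (g \<xi>) * complex_of_real (W \<xi>)) \<le> norm (?f\<^sup>2 * W \<xi> + ?g\<^sup>2 * W \<xi>)"
      using W by (simp add: norm_mult distrib_right)
  qed
qed

lemma laplace_in_hardy_sobolev:
  "f \<in> L2_weighted \<Omega> \<rho> n \<Longrightarrow> laplace \<Omega> f \<in> hardy_sobolev \<Omega> \<rho> n"
  using holomorphic_laplace[OF L2_weighted_exp_integrable] by (auto simp: hardy_sobolev_def)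

lemma hs_density:
  assumes "F \<in> hardy_sobolev \<Omega> \<rho> n"
  shows "hs_density \<Omega> \<rho> n F \<in> L2_weighted \<Omega> \<rho> n" and "F = laplace \<Omega> (hs_density \<Omega> \<rho> n F)"
proof -
  have "\<exists>f. f \<in> L2_weighted \<Omega> \<rho> n \<and> F = laplace \<Omega> f"
    using assms by (auto simp: hardy_sobolev_def)
  from someI_ex[OF this]
  show "hs_density \<Omega> \<rho> n F \<in> L2_weighted \<Omega> \<rho> n" "F = laplace \<Omega> (hs_density \<Omega> \<rho> n F)"
    by (auto simp: hs_density_def)
qed

text \<open>
  The density that the choice operator selects is, by injectivity, the given one up to a null set.
\<close>

lemma hs_density_laplace:
  assumes f: "f \<in> L2_weighted \<Omega> \<rho> n"
  shows "AE \<xi> in M. hs_density \<Omega> \<rho> n (laplace \<Omega> f) \<xi> = f \<xi>"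
  using hs_density[OF laplace_in_hardy_sobolev[OF f]]
  by (intro laplace_eq_imp_AE_eq L2_weighted_exp_integrable f) auto

definition kernel_density :: "complex^'d \<Rightarrow> real^'d \<Rightarrow> complex" where
  "kernel_density w \<xi> = exp (- \<i> * cpair (cnj_vec w) \<xi>) / complex_of_real (W \<xi>)"

lemma cnj_kernel_density:
  "cnj (kernel_density w \<xi>) * complex_of_real (W \<xi>) = exp (\<i> * cpair w \<xi>)"
  using weight_ge_1[of \<xi>] by (simp add: kernel_density_def exp_cnj cpair_cnj_vec)

lemma norm_kernel_density: "norm (kernel_density w \<xi>) = exp (- (Im_vec w \<bullet> \<xi>)) / W \<xi>"
proof -
  have "norm (cnj (kernel_density w \<xi>) * complex_of_real (W \<xi>)) = exp (- (Im_vec w \<bullet> \<xi>))"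
    by (simp only: cnj_kernel_density norm_exp_i_cpair)
  then show ?thesis
    using weight_ge_1[of \<xi>] by (simp add: norm_mult eq_divide_eq)
qed

lemma kernel_density_L2:
  assumes w: "w \<in> tube \<Omega>"
  shows "kernel_density w \<in> L2_weighted \<Omega> \<rho> n"
proof -
  have Wm [measurable]: "W \<in> borel_measurable M" by (rule weight_measurable)
  have "(\<lambda>\<xi>. exp (- \<i> * cpair (cnj_vec w) \<xi>)) \<in> borel_measurable M"
    by (intro measurable_lebesgue_on_continuous continuous_intros)
  then have m [measurable]: "kernel_density w \<in> borel_measurable M"
    unfolding kernel_density_def[abs_def] by measurable
  have "integrable M (\<lambda>\<xi>. (cmod (kernel_density w \<xi>))\<^sup>2 * W \<xi>)"
  proof (rule Bochner_Integration.integrable_bound)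
    show "integrable M (\<lambda>\<xi>. exp (- (2 *\<^sub>R Im_vec w \<bullet> \<xi>)))"
      using w scaleR_mem[of "Im_vec w" 2]
      by (intro integrable_exp_minus_inner_dual_cone open_set) (auto simp: mem_tube_iff)
    show "(\<lambda>\<xi>. (cmod (kernel_density w \<xi>))\<^sup>2 * W \<xi>) \<in> borel_measurable M" by measurable
    show "AE \<xi> in M. norm ((cmod (kernel_density w \<xi>))\<^sup>2 * W \<xi>) \<le> norm (exp (- (2 *\<^sub>R Im_vec w \<bullet> \<xi>)))"
    proof (rule AE_I2)
      fix \<xi>
      have "(cmod (kernel_density w \<xi>))\<^sup>2 * W \<xi> = (exp (- (Im_vec w \<bullet> \<xi>)))\<^sup>2 / W \<xi>"
        using weight_ge_1[of \<xi>] by (simp add: norm_kernel_density power2_eq_square)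
      also have "\<dots> \<le> (exp (- (Im_vec w \<bullet> \<xi>)))\<^sup>2"
        using weight_ge_1[of \<xi>] by (simp add: divide_le_eq mult_right_le_one_le)
      also have "\<dots> = exp (- (2 *\<^sub>R Im_vec w \<bullet> \<xi>))" by (simp flip: exp_double)
      finally show "norm ((cmod (kernel_density w \<xi>))\<^sup>2 * W \<xi>) \<le> norm (exp (- (2 *\<^sub>R Im_vec w \<bullet> \<xi>)))"
        using weight_ge_1[of \<xi>] by simp
    qed
  qed
  with m show ?thesis by (simp add: L2_weighted_def)
qed

text \<open>
  Multiplying the conjugate of the kernel density by the weight leaves exactly \<open>exp (i\<langle>w, \<xi>\<rangle>)\<close>, so the
  inner product is the Laplace integral of the density of \<open>F\<close> at \<open>w\<close>.
\<close>

lemma kernel_density_reproducing: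
  assumes w: "w \<in> tube \<Omega>" and F: "F \<in> hardy_sobolev \<Omega> \<rho> n"
  shows "hs_inner \<Omega> \<rho> n F (laplace \<Omega> (kernel_density w)) = F w"
proof -
  let ?d = "hs_density \<Omega> \<rho> n" and ?K = "laplace \<Omega> (kernel_density w)"
  note k = kernel_density_L2[OF w]
  have meas: "?d F \<in> borel_measurable M" "?d ?K \<in> borel_measurable M" "W \<in> borel_measurable M"
    using hs_density(1)[OF F] hs_density(1)[OF laplace_in_hardy_sobolev[OF k]] weight_measurable
    by (auto simp: L2_weighted_def)
  have "hs_inner \<Omega> \<rho> n F ?K = (LINT \<xi>|M. exp (\<i> * cpair w \<xi>) * ?d F \<xi>)"
    unfolding hs_inner_def
  proof (rule integral_cong_AE)
    show "AE \<xi> in M. ?d F \<xi> * cnj (?d ?K \<xi>) * complex_of_real (W \<xi>) = exp (\<i> * cpair w \<xi>) * ?d F \<xi>"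
      using hs_density_laplace[OF k]
    proof (rule AE_mp, intro AE_I2 impI)
      fix \<xi> assume "?d ?K \<xi> = kernel_density w \<xi>"
      then show "?d F \<xi> * cnj (?d ?K \<xi>) * complex_of_real (W \<xi>) = exp (\<i> * cpair w \<xi>) * ?d F \<xi>"
        by (simp only: mult.assoc cnj_kernel_density) (simp only: mult.commute)
    qed
    show "(\<lambda>\<xi>. exp (\<i> * cpair w \<xi>) * ?d F \<xi>) \<in> borel_measurable M"
      using measurable_exp_cpair meas(1) by (rule borel_measurable_times)
  qed (use meas in measurable)
  also have "\<dots> = laplace \<Omega> (?d F) w" using w by (simp add: laplace_def)
  also have "\<dots> = F w" using hs_density(2)[OF F] by simp
  finally show ?thesis .
qed

text \<open>
  Evaluating the reproducing property at \<open>F = K\<close> and \<open>F = L\<close> shows that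
  \<open>\<langle>K, K\<rangle> - \<langle>K, L\<rangle> - \<langle>L, K\<rangle> + \<langle>L, L\<rangle> = 0\<close>. This is the weighted square norm of the difference of the
  chosen densities; working with these avoids relating them to the density chosen for \<open>K - L\<close>.
\<close>

lemma reproducing_unique:
  assumes K: "K \<in> hardy_sobolev \<Omega> \<rho> n" "\<And>F. F \<in> hardy_sobolev \<Omega> \<rho> n \<Longrightarrow> F w = hs_inner \<Omega> \<rho> n F K"
    and L: "L \<in> hardy_sobolev \<Omega> \<rho> n" "\<And>F. F \<in> hardy_sobolev \<Omega> \<rho> n \<Longrightarrow> F w = hs_inner \<Omega> \<rho> n F L"
  shows "K = L"
proof -
  let ?d = "hs_density \<Omega> \<rho> n"
  let ?I = "\<lambda>F G \<xi>. ?d F \<xi> * cnj (?d G \<xi>) * complex_of_real (W \<xi>)"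
  have i: "integrable M (?I F G)" if "F \<in> hardy_sobolev \<Omega> \<rho> n" "G \<in> hardy_sobolev \<Omega> \<rho> n" for F G
    using that by (intro L2_weighted_integrable_mult hs_density)
  have sq: "(?I K K \<xi> - ?I K L \<xi>) - (?I L K \<xi> - ?I L L \<xi>)
      = complex_of_real ((cmod (?d K \<xi> - ?d L \<xi>))\<^sup>2 * W \<xi>)" for \<xi>
    unfolding of_real_mult complex_norm_square by (simp add: algebra_simps)
  have "has_bochner_integral M (\<lambda>\<xi>. (?I K K \<xi> - ?I K L \<xi>) - (?I L K \<xi> - ?I L L \<xi>))
      ((hs_inner \<Omega> \<rho> n K K - hs_inner \<Omega> \<rho> n K L) - (hs_inner \<Omega> \<rho> n L K - hs_inner \<Omega> \<rho> n L L))"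
    unfolding hs_inner_def
    by (intro has_bochner_integral_diff has_bochner_integral_integrable i K L)
  then have "has_bochner_integral M (\<lambda>\<xi>. complex_of_real ((cmod (?d K \<xi> - ?d L \<xi>))\<^sup>2 * W \<xi>)) 0"
    unfolding sq using K(2)[OF K(1)] K(2)[OF L(1)] L(2)[OF K(1)] L(2)[OF L(1)] by simp
  then have "integrable M (\<lambda>\<xi>. (cmod (?d K \<xi> - ?d L \<xi>))\<^sup>2 * W \<xi>)"
    "(LINT \<xi>|M. (cmod (?d K \<xi> - ?d L \<xi>))\<^sup>2 * W \<xi>) = 0"
    unfolding has_bochner_integral_iff complex_of_real_integrable_eq integral_complex_of_real
    by auto
  then have "AE \<xi> in M. (cmod (?d K \<xi> - ?d L \<xi>))\<^sup>2 * W \<xi> = 0"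
    using order_trans[OF zero_le_one weight_ge_1]
    by (subst (asm) integral_nonneg_eq_0_iff_AE) (auto intro!: AE_I2 mult_nonneg_nonneg)
  then have ae: "AE \<xi> in M. ?d K \<xi> = ?d L \<xi>"
  proof (rule AE_mp, intro AE_I2 impI)
    fix \<xi> assume "(cmod (?d K \<xi> - ?d L \<xi>))\<^sup>2 * W \<xi> = 0"
    then show "?d K \<xi> = ?d L \<xi>" using weight_ge_1[of \<xi>] by auto
  qed
  have "laplace \<Omega> (?d K) = laplace \<Omega> (?d L)"
    unfolding laplace_def
  proof (rule restrict_ext, rule integral_cong_AE)
    fix z assume "z \<in> tube \<Omega>"
    then show "(\<lambda>\<xi>. exp (\<i> * cpair z \<xi>) * ?d K \<xi>) \<in> borel_measurable M"
      "(\<lambda>\<xi>. exp (\<i> * cpair z \<xi>) * ?d L \<xi>) \<in> borel_measurable M"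
      using integrable_laplace[OF L2_weighted_exp_integrable[OF hs_density(1)[OF K(1)]]]
        integrable_laplace[OF L2_weighted_exp_integrable[OF hs_density(1)[OF L(1)]]]
      by auto
    show "AE \<xi> in M. exp (\<i> * cpair z \<xi>) * ?d K \<xi> = exp (\<i> * cpair z \<xi>) * ?d L \<xi>"
      using ae by (rule AE_mp) (auto intro!: AE_I2)
  qed
  then show ?thesis using hs_density(2)[OF K(1)] hs_density(2)[OF L(1)] by simp
qed

lemma hs_kernel_at_eq_laplace:
  assumes w: "w \<in> tube \<Omega>"
  shows "hs_kernel_at \<Omega> \<rho> n w = laplace \<Omega> (kernel_density w)"
  unfolding hs_kernel_at_def
proof (rule the_equality)
  show K: "laplace \<Omega> (kernel_density w) \<in> hardy_sobolev \<Omega> \<rho> n \<and>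
      (\<forall>F\<in>hardy_sobolev \<Omega> \<rho> n. F w = hs_inner \<Omega> \<rho> n F (laplace \<Omega> (kernel_density w)))"
    using laplace_in_hardy_sobolev[OF kernel_density_L2[OF w]] kernel_density_reproducing[OF w] by simp
  fix L assume "L \<in> hardy_sobolev \<Omega> \<rho> n \<and> (\<forall>F\<in>hardy_sobolev \<Omega> \<rho> n. F w = hs_inner \<Omega> \<rho> n F L)"
  with K show "L = laplace \<Omega> (kernel_density w)" by (intro reproducing_unique[of _ w]) auto
qed

end

theorem theorem6p1:
  fixes \<Omega> :: "(real^'d) set" and \<rho> :: "real^'d \<Rightarrow> real" and n :: nat and z w :: "complex^'d"
  assumes "\<Omega> \<noteq> {}" and "open \<Omega>" and "convex \<Omega>"
    and "\<And>x t. x \<in> \<Omega> \<Longrightarrow> t > 0 \<Longrightarrow> t *\<^sub>R x \<in> \<Omega>"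
    and "\<not> (\<exists>a v. v \<noteq> 0 \<and> (\<forall>t. a + t *\<^sub>R v \<in> \<Omega>))"
    and "continuous_on (dual_cone \<Omega>) \<rho>"
    and "\<And>\<xi>. \<xi> \<in> dual_cone \<Omega> \<Longrightarrow> \<rho> \<xi> \<ge> 0"
    and "\<And>\<xi>. \<xi> \<in> dual_cone \<Omega> \<Longrightarrow> \<xi> \<noteq> 0 \<Longrightarrow> \<rho> \<xi> > 0"
    and "\<And>\<xi> t. \<xi> \<in> dual_cone \<Omega> \<Longrightarrow> t > 0 \<Longrightarrow> \<rho> (t *\<^sub>R \<xi>) = t * \<rho> \<xi>"
    and "z \<in> tube \<Omega>" and "w \<in> tube \<Omega>"
  shows "has_bochner_integral (lebesgue_on (dual_cone \<Omega>))
           (\<lambda>\<xi>. exp (\<i> * cpair (z - cnj_vec w) \<xi>) / complex_of_real (hs_weight \<rho> n \<xi>))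
           (hs_kernel \<Omega> \<rho> n z w) \<and>
         has_bochner_integral (lebesgue_on (dual_cone \<Omega>))
           (\<lambda>\<xi>. exp (\<i> * cpair z \<xi>) *
              (exp (- \<i> * cpair (cnj_vec w) \<xi>) / complex_of_real (hs_weight \<rho> n \<xi>)))
           (hs_kernel_at \<Omega> \<rho> n w z)"
proof -
  interpret weighted_cone \<Omega> \<rho> n
    using assms by unfold_locales auto
  have "hs_kernel_at \<Omega> \<rho> n w z = (LINT \<xi>|M. exp (\<i> * cpair z \<xi>) * kernel_density w \<xi>)"
    using assms(10,11) by (simp add: hs_kernel_at_eq_laplace laplace_def)
  then have *: "has_bochner_integral M (\<lambda>\<xi>. exp (\<i> * cpair z \<xi>) * kernel_density w \<xi>) (hs_kernel_at \<Omega> \<rho> n w z)"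
    using integrable_laplace[OF L2_weighted_exp_integrable[OF kernel_density_L2[OF assms(11)]] assms(10)]
    by (simp add: has_bochner_integral_integrable)
  moreover have "exp (\<i> * cpair z \<xi>) * kernel_density w \<xi>
      = exp (\<i> * cpair (z - cnj_vec w) \<xi>) / complex_of_real (hs_weight \<rho> n \<xi>)" for \<xi>
    by (simp add: kernel_density_def cpair_diff right_diff_distrib exp_diff exp_minus divide_inverse)
  ultimately have "has_bochner_integral M
      (\<lambda>\<xi>. exp (\<i> * cpair (z - cnj_vec w) \<xi>) / complex_of_real (hs_weight \<rho> n \<xi>)) (hs_kernel_at \<Omega> \<rho> n w z)"
    by simp
  with * show ?thesis
    unfolding hs_kernel_def kernel_density_def by blast
qed

end
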